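(* Let $G=(K\uplus S,E)$ be a connected split graph and let $D_s,D_t$ be two D$2$DSs of $G$ of the same size $k$. Then (a) $M^\star_{\mathsf{TS}}(G,D_s,D_t)\le \mathrm{opt}_{\mathsf{TS}}(G,D_s,D_t)\le M^\star_{\mathsf{TS}}(G,D_s,D_t)+2$; (b) $M^\star_{\mathsf{TJ}}(G,D_s,D_t)\le \mathrm{opt}_{\mathsf{TJ}}(G,D_s,D_t)\le M^\star_{\mathsf{TJ}}(G,D_s,D_t)+1$. Moreover, there exist instances (a connected split graph $G$ and D$2$DSs $D_s,D_t$ of equal size) with $\mathrm{opt}_{\mathsf{TS}}(G,D_s,D_t)=M^\star_{\mathsf{TS}}(G,D_s,D_t)+2$, and instances with $\mathrm{opt}_{\mathsf{TJ}}(G,D_s,D_t)=M^\star_{\mathsf{TJ}}(G,D_s,D_t)+1$.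
   Context: Graphs are finite, simple, undirected and connected. A split graph $G=(K\uplus S,E)$ has vertex set partitioned into a clique $K$ and an independent set $S$. A D$2$DS of $G$ is a set $D\subseteq V(G)$ such that every vertex is at distance at most $2$ from some vertex of $D$. A $\mathsf{TJ}$-sequence between D$2$DSs $D_s,D_t$ is a sequence $D_s=D_0,\dots,D_q=D_t$ of D$2$DSs with $D_i\setminus D_{i+1}=\{x_i\}$, $D_{i+1}\setminus D_i=\{y_i\}$ for each $i$; a $\mathsf{TS}$-sequence additionally requires $x_iy_i\in E(G)$; its length is $q$. For $\mathsf{R}\in\{\mathsf{TS},\mathsf{TJ}\}$, $\mathrm{opt}_{\mathsf{R}}(G,D_s,D_t)$ is the minimum length of an $\mathsf{R}$-sequence between $D_s$ and $D_t$ ($\infty$ if none exists). With $D_s=\{s_1,\dots,s_k\}$, $M^\star_{\mathsf{TS}}(G,D_s,D_t)=\min_f\sum_{i=1}^k \mathrm{dist}_G(s_i,f(s_i))$ over all bijections $f:D_s\to D_t$, and $M^\star_{\mathsf{TJ}}(G,D_s,D_t)=|D_s\,\Delta\, D_t|/2$. *)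

theory Defs
  imports "Graph_Theory.Graph_Theory" "HOL-Library.Extended_Nat"
begin

definition split_graph :: "'a pair_pre_digraph \<Rightarrow> 'a set \<Rightarrow> 'a set \<Rightarrow> bool" where
  "split_graph G K S \<longleftrightarrow>
     pair_graph G \<and> K \<union> S = pverts G \<and> K \<inter> S = {} \<and>
     (\<forall>u\<in>K. \<forall>v\<in>K. u \<noteq> v \<longrightarrow> (u, v) \<in> parcs G) \<and>
     (\<forall>u\<in>S. \<forall>v\<in>S. (u, v) \<notin> parcs G)"

definition gdist :: "'a pair_pre_digraph \<Rightarrow> 'a \<Rightarrow> 'a \<Rightarrow> enat" where
  "gdist G u v = (INF p\<in>{p. pre_digraph.awalk (with_proj G) u p v}. enat (length p))"

definition D2DS :: "'a pair_pre_digraph \<Rightarrow> 'a set \<Rightarrow> bool" where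
  "D2DS G D \<longleftrightarrow> D \<subseteq> pverts G \<and> (\<forall>v\<in>pverts G. \<exists>u\<in>D. gdist G v u \<le> 2)"

datatype reconf_rule = TS | TJ

definition reconf_step ::
    "reconf_rule \<Rightarrow> 'a pair_pre_digraph \<Rightarrow> 'a set \<Rightarrow> 'a set \<Rightarrow> bool" where
  "reconf_step R G D D' \<longleftrightarrow>
     (\<exists>x y. D - D' = {x} \<and> D' - D = {y} \<and> (R = TS \<longrightarrow> (x, y) \<in> parcs G))"

definition reconf_seq ::
    "reconf_rule \<Rightarrow> 'a pair_pre_digraph \<Rightarrow> 'a set \<Rightarrow> 'a set list \<Rightarrow> 'a set \<Rightarrow> bool" where
  "reconf_seq R G Ds Dseq Dt \<longleftrightarrow>
     Dseq \<noteq> [] \<and> hd Dseq = Ds \<and> last Dseq = Dt \<and>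
     (\<forall>D\<in>set Dseq. D2DS G D) \<and> successively (reconf_step R G) Dseq"

text \<open>A sequence \<open>D\<^sub>0, \<dots>, D\<^sub>q\<close> has \<open>q + 1\<close> entries and length \<open>q\<close>;
  the infimum over the empty set is \<open>\<infinity>\<close>.\<close>

definition opt ::
    "reconf_rule \<Rightarrow> 'a pair_pre_digraph \<Rightarrow> 'a set \<Rightarrow> 'a set \<Rightarrow> enat" where
  "opt R G Ds Dt = (INF Dseq\<in>{Dseq. reconf_seq R G Ds Dseq Dt}. enat (length Dseq - 1))"

definition Mstar_TS :: "'a pair_pre_digraph \<Rightarrow> 'a set \<Rightarrow> 'a set \<Rightarrow> enat" where
  "Mstar_TS G Ds Dt = (INF f\<in>{f. bij_betw f Ds Dt}. \<Sum>s\<in>Ds. gdist G s (f s))"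

definition Mstar_TJ :: "'a pair_pre_digraph \<Rightarrow> 'a set \<Rightarrow> 'a set \<Rightarrow> enat" where
  "Mstar_TJ G Ds Dt = enat (card (sym_diff Ds Dt) div 2)"

text \<open>The integer division above is exact for finite sets of equal size.\<close>

lemma even_card_sym_diff:
  assumes "finite A" "finite B" "card A = card B"
  shows "even (card (sym_diff A B))"
proof -
  have "card (sym_diff A B) = card (A - B) + card (B - A)"
    using assms by (intro card_Un_disjoint) auto
  moreover have "card (A - B) = card (B - A)"
    using assms by (simp add: card_Diff_subset_Int Int_commute)
  ultimately show ?thesis by simp
qed

end

theory Submission
  imports Defs
begin

text \<open>
  In a connected split graph every vertex set meeting the clique \<open>K\<close> is a distance-2 dominating set.
  The lower bounds follow by tracking tokens.

  For the upper bound under \<open>TS\<close>, fix a minimum-cost matching from \<open>D\<^sub>s\<close> to \<open>D\<^sub>t\<close> which is the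
  identity on \<open>D\<^sub>s \<inter> D\<^sub>t\<close>. A case analysis shows that some slide, from \<open>D\<^sub>s\<close> or backwards from
  \<open>D\<^sub>t\<close>, lowers the matching cost and preserves domination, except when \<open>D\<^sub>s\<close> and \<open>D\<^sub>t\<close> share exactly
  one clique vertex \<open>u\<close>, all moving tokens start and end in the independent set next to \<open>u\<close>, and
  \<open>K \<noteq> {u}\<close>. Then the token on \<open>u\<close> steps aside to another clique vertex, all tokens are routed through
  \<open>u\<close>, and the token returns: two extra slides.

  Under \<open>TJ\<close> a single token parked in \<open>K\<close>, at the cost of at most one extra jump, makes all
  remaining exchanges admissible.
\<close>

section \<open>Distances\<close>

lemma enat_Inf_mem: "X \<noteq> {} \<Longrightarrow> Inf X \<in> X" for X :: "enat set"
  unfolding Inf_enat_def by (metis (mono_tags, lifting) LeastI ex_in_conv)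

text \<open>Since \<open>enat\<close> is well-ordered, an infimum bounded by a finite number is
  attained. This turns bounds on \<open>gdist\<close> and \<open>opt\<close> into the existence of
  one short walk or sequence.\<close>

lemma enat_INF_le_iff: "(INF x\<in>X. enat (f x)) \<le> enat n \<longleftrightarrow> (\<exists>x\<in>X. f x \<le> n)"
proof
  assume le: "(INF x\<in>X. enat (f x)) \<le> enat n"
  then have "X \<noteq> {}"
    by (auto simp: Inf_enat_def)
  then have "(INF x\<in>X. enat (f x)) \<in> (\<lambda>x. enat (f x)) ` X"
    by (intro enat_Inf_mem) simp
  with le show "\<exists>x\<in>X. f x \<le> n"
    by auto
next
  assume "\<exists>x\<in>X. f x \<le> n"
  then show "(INF x\<in>X. enat (f x)) \<le> enat n"
    by (auto intro: INF_lower2)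
qed

lemma gdist_le_iff:
  "gdist G u v \<le> enat n \<longleftrightarrow> (\<exists>p. pre_digraph.awalk (with_proj G) u p v \<and> length p \<le> n)"
  unfolding gdist_def enat_INF_le_iff by simp

text \<open>Distance truncated at 3. Unlike \<^const>\<open>gdist\<close> it satisfies the triangle inequality for
  arbitrary points and is always finite; on connected split graphs both agree.\<close>

definition short_dist :: "('a \<times> 'a) set \<Rightarrow> 'a \<Rightarrow> 'a \<Rightarrow> nat" where
  "short_dist E u v = (if u = v then 0 else if (u, v) \<in> E then 1
     else if \<exists>w. (u, w) \<in> E \<and> (w, v) \<in> E then 2 else 3)"

lemma short_dist_self [simp]: "short_dist E u u = 0"
  by (simp add: short_dist_def)

lemma short_dist_triangle: "short_dist E u w \<le> short_dist E u v + short_dist E v w"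
  unfolding short_dist_def by auto

lemma short_dist_edge: "(u, v) \<in> E \<Longrightarrow> short_dist E u v \<le> 1"
  by (simp add: short_dist_def)

lemma short_dist_sym: "sym E \<Longrightarrow> short_dist E u v = short_dist E v u"
  unfolding short_dist_def by (auto dest: symD)

lemma (in pair_wf_digraph) gdist_le_012:
  assumes "u \<in> pverts G"
  shows "gdist G u v \<le> enat 0 \<longleftrightarrow> u = v"
    and "gdist G u v \<le> enat 1 \<longleftrightarrow> u = v \<or> (u, v) \<in> parcs G"
    and "gdist G u v \<le> enat 2 \<longleftrightarrow>
      u = v \<or> (u, v) \<in> parcs G \<or> (\<exists>w. (u, w) \<in> parcs G \<and> (w, v) \<in> parcs G)"
proof -
  have verts: "x \<in> pverts G" "y \<in> pverts G" if "(x, y) \<in> parcs G" for x y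
    using that arc_fst_in_verts arc_snd_in_verts by fastforce+
  have w0: "awalk u [] v \<longleftrightarrow> u = v"
    using assms by (auto simp: awalk_simps)
  have w1: "awalk u [e] v \<longleftrightarrow> e = (u, v) \<and> (u, v) \<in> parcs G" for e
    using assms by (cases e) (auto simp: awalk_simps dest: verts)
  have w2: "awalk u [e, e'] v \<longleftrightarrow>
      (\<exists>w. e = (u, w) \<and> e' = (w, v) \<and> (u, w) \<in> parcs G \<and> (w, v) \<in> parcs G)" for e e'
    using assms by (cases e; cases e') (auto simp: awalk_simps dest: verts)
  have le1: "length p \<le> 1 \<longleftrightarrow> p = [] \<or> (\<exists>e. p = [e])" for p :: "('a \<times> 'a) list"
    by (cases p) auto
  have le2: "length p \<le> 2 \<longleftrightarrow> p = [] \<or> (\<exists>e. p = [e]) \<or> (\<exists>e e'. p = [e, e'])"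
    for p :: "('a \<times> 'a) list"
    by (cases p; cases "tl p") auto
  show "gdist G u v \<le> enat 0 \<longleftrightarrow> u = v"
    unfolding gdist_le_iff using w0 by auto
  show "gdist G u v \<le> enat 1 \<longleftrightarrow> u = v \<or> (u, v) \<in> parcs G"
    unfolding gdist_le_iff le1 using w0 w1 by blast
  show "gdist G u v \<le> enat 2 \<longleftrightarrow>
      u = v \<or> (u, v) \<in> parcs G \<or> (\<exists>w. (u, w) \<in> parcs G \<and> (w, v) \<in> parcs G)"
    unfolding gdist_le_iff le2 using w0 w1 w2 by blast
qed

section \<open>Matchings of minimum cost\<close>

text \<open>A bijection of cost exactly \<open>n\<close>, not necessarily the least cost. Building
  it pair by pair makes it easy to remove a pair and reconnect the two ends, without editing a
  function.\<close>

inductive matched :: "('a \<Rightarrow> 'a \<Rightarrow> nat) \<Rightarrow> 'a set \<Rightarrow> 'a set \<Rightarrow> nat \<Rightarrow> bool"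
  for d where
  empty: "matched d {} {} 0"
| insert: "\<lbrakk>matched d A B n; a \<notin> A; b \<notin> B\<rbrakk> \<Longrightarrow> matched d (insert a A) (insert b B) (d a b + n)"

lemma matched_finite:
  assumes "matched d A B n"
  shows "finite A" "finite B" "card A = card B"
  using assms by (induction) auto

lemma matched_sym:
  assumes "matched d A B n" and sym: "\<And>x y. d x y = d y x"
  shows "matched d B A n"
  using assms(1)
proof induction
  case (insert A B n a b)
  then have "matched d (insert b B) (insert a A) (d b a + n)"
    by (intro matched.insert)
  then show ?case
    by (simp add: sym)
qed (rule matched.empty)

lemma matched_Diff:
  assumes "matched d A B n" "a \<in> A"
  obtains b m where "b \<in> B" "matched d (A - {a}) (B - {b}) m" "n = d a b + m"
proof -
  have "\<exists>b m. b \<in> B \<and> matched d (A - {a}) (B - {b}) m \<and> n = d a b + m"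
    using assms
  proof induction
    case (insert A B n x y)
    show ?case
    proof (cases "a = x")
      case True
      with insert show ?thesis
        by (intro exI[of _ y] exI[of _ n]) auto
    next
      case False
      with insert obtain b m
        where *: "b \<in> B" "matched d (A - {a}) (B - {b}) m" "n = d a b + m"
        by blast
      then have "matched d (insert x (A - {a})) (insert y (B - {b})) (d x y + m)"
        using insert by (intro matched.insert) auto
      moreover have "insert x (A - {a}) = insert x A - {a}" "insert y (B - {b}) = insert y B - {b}"
        using False * insert by auto
      ultimately show ?thesis
        using * by (intro exI[of _ b] exI[of _ "d x y + m"]) auto
    qed
  qed simp
  then show thesis
    using that by blast
qed

lemma matched_insert_Diff:
  assumes "matched d (A - {a}) (B - {b}) m" "a \<in> A" "b \<in> B"
  shows "matched d A B (d a b + m)"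
  using matched.insert[OF assms(1), of a b] assms(2,3) by (simp add: insert_absorb)

lemma matched_bij_betw:
  assumes "finite A" "bij_betw f A B"
  shows "matched d A B (\<Sum>a\<in>A. d a (f a))"
  using assms
proof (induction A arbitrary: B)
  case empty
  then show ?case
    by (auto simp: bij_betw_def intro: matched.empty)
next
  case (insert a A)
  have "bij_betw f A (B - {f a})"
    using insert.prems insert.hyps unfolding bij_betw_def by (auto; metis imageI)
  with insert.IH have "matched d A (B - {f a}) (\<Sum>x\<in>A. d x (f x))"
    by blast
  from matched.insert[OF this insert.hyps(2), of "f a"] insert.prems insert.hyps
  show ?case
    by (auto simp: bij_betw_def insert_absorb)
qed

lemma matched_imp_bij_betw:
  assumes "matched d A B n"
  obtains f where "bij_betw f A B" "n = (\<Sum>a\<in>A. d a (f a))"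
proof -
  have "\<exists>f. bij_betw f A B \<and> n = (\<Sum>a\<in>A. d a (f a))"
    using assms
  proof induction
    case empty
    show ?case by (simp add: bij_betw_def)
  next
    case (insert A B n a b)
    then obtain f where f: "bij_betw f A B" "n = (\<Sum>a\<in>A. d a (f a))"
      by blast
    let ?f = "f(a := b)"
    have "bij_betw ?f A B"
      using f(1) insert.hyps by (subst bij_betw_cong[of A ?f f]) auto
    then have "bij_betw ?f (insert a A) (insert b B)"
      using insert.hyps notIn_Un_bij_betw[of a A ?f B] by simp
    moreover have "(\<Sum>x\<in>insert a A. d x (?f x)) = d a b + (\<Sum>x\<in>A. d x (?f x))"
      using insert.hyps matched_finite(1)[of d A B n] by simp
    moreover have "(\<Sum>x\<in>A. d x (?f x)) = n"
      unfolding f(2) using insert.hyps by (intro sum.cong) auto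
    ultimately show ?case
      by metis
  qed
  then show thesis
    using that by blast
qed

lemma matched_ge:
  assumes "matched d A B n" "\<And>a b. a \<in> A \<Longrightarrow> b \<in> B \<Longrightarrow> c \<le> d a b"
  shows "c * card A \<le> n"
  using assms
proof induction
  case (insert A B n a b)
  then have "c \<le> d a b" "c * card A \<le> n" by auto
  moreover have "card (insert a A) = Suc (card A)"
    using insert.hyps matched_finite(1)[OF insert.hyps(1)] by simp
  ultimately show ?case
    by simp
qed simp

section \<open>Exchange arguments for matchings under a metric\<close>

locale metric_matching =
  fixes d :: "'a \<Rightarrow> 'a \<Rightarrow> nat"
  assumes self [simp]: "d x x = 0"
    and sym: "d x y = d y x"
    and triangle: "d x z \<le> d x y + d y z"
begin

lemma matched_swap: "matched d A B n \<Longrightarrow> matched d B A n"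
  using matched_sym sym by blast

text \<open>By the triangle inequality the partners of \<open>x\<close> on both sides may be matched directly.\<close>

lemma matched_remove_common:
  assumes "matched d A B n" "x \<in> A" "x \<in> B"
  obtains m where "matched d (A - {x}) (B - {x}) m" "m \<le> n"
proof -
  obtain b m where b: "b \<in> B" "matched d (A - {x}) (B - {b}) m" "n = d x b + m"
    using matched_Diff assms(1,2) by metis
  show thesis
  proof (cases "b = x")
    case False
    then have "x \<in> B - {b}" using assms(3) by simp
    then obtain a m' where a: "a \<in> A - {x}" "matched d (B - {b} - {x}) (A - {x} - {a}) m'" 
        "m = d x a + m'"
      using matched_Diff matched_swap[OF b(2)] by metis
    have "matched d (A - {x}) (B - {x}) (d a b + m')"
      using a b False matched_swap[OF a(2)]
      by (intro matched_insert_Diff)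
        (auto simp: insert_commute Diff_insert2[symmetric] Diff_insert[symmetric])
    moreover have "d a b + m' \<le> n"
      using triangle[of a b x] a(3) b(3) sym[of a x] by simp
    ultimately show thesis using that by blast
  qed (use b that in auto)
qed

text \<open>Common points are removed one at a time at no cost until none is left; then the partner
  of \<open>a\<close> must lie outside \<open>A\<close>. Putting the common points back, each
  matched to itself, costs nothing. So a token that has to move can be given a target that is vacant
  in \<open>A\<close>.\<close>

lemma matched_keep_common:
  assumes "matched d A B n" "a \<in> A - B"
  obtains b m where "b \<in> B - A" "matched d (A - {a}) (B - {b}) m" "d a b + m \<le> n"
proof -
  have "\<exists>b m. b \<in> B - A \<and> matched d (A - {a}) (B - {b}) m \<and> d a b + m \<le> n"
    using assms
  proof (induction "card (A \<inter> B)" arbitrary: A B n)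
    case 0
    then have "A \<inter> B = {}"
      using matched_finite(1)[OF 0(2)] by simp
    then show ?case
      using matched_Diff[OF 0(2), of a] 0(3) by (metis DiffD1 IntI DiffI empty_iff order_refl)
  next
    case (Suc k)
    then obtain x where x: "x \<in> A" "x \<in> B"
      by (metis IntE card_eq_0_iff ex_in_conv nat.distinct(1))
    then obtain m where m: "matched d (A - {x}) (B - {x}) m" "m \<le> n"
      using matched_remove_common Suc.prems(1) by metis
    have "k = card ((A - {x}) \<inter> (B - {x}))"
    proof -
      have "(A - {x}) \<inter> (B - {x}) = A \<inter> B - {x}" by blast
      then show ?thesis
        using Suc.hyps(2) x by (simp add: card_Diff_singleton flip: Suc.hyps(2))
    qed
    from Suc.hyps(1)[OF this m(1)] Suc.prems(2) x obtain b l where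
      b: "b \<in> B - {x} - (A - {x})" "matched d (A - {x} - {a}) (B - {x} - {b}) l" "d a b + l \<le> m"
      by auto
    have "matched d (A - {a}) (B - {b}) (d x x + l)"
      using b x Suc.prems(2)
      by (intro matched_insert_Diff)
        (auto simp: insert_commute Diff_insert2[symmetric] Diff_insert[symmetric])
    then show ?case
      using b m(2) by (intro exI[of _ b] exI[of _ l]) auto
  qed
  then show thesis
    using that by blast
qed

lemma matched_Diff_Diff:
  assumes "matched d A B n"
  obtains m where "matched d (A - B) (B - A) m" "m \<le> n"
proof -
  have "\<exists>m\<le>n. matched d (A - X) (B - X) m" if "finite X" "X \<subseteq> A \<inter> B" for X
    using that
  proof induction
    case empty
    then show ?case using assms by auto
  next
    case (insert x X)
    then obtain m where "m \<le> n" "matched d (A - X) (B - X) m" by auto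
    moreover have "x \<in> A - X" "x \<in> B - X" using insert by auto
    ultimately show ?case
      using matched_remove_common[of "A - X" "B - X" m x] by (metis Diff_insert order_trans)
  qed
  from this[of "A \<inter> B"] matched_finite(1)[OF assms] show thesis
    using that by (auto simp: Diff_Int)
qed

end

section \<open>Reconfiguration sequences\<close>

lemma reconf_seq_Cons:
  assumes "D2DS G A" "reconf_step R G A A'" "reconf_seq R G A' l B"
  shows "reconf_seq R G A (A # l) B"
  using assms by (auto simp: reconf_seq_def successively_Cons)

text \<open>The target \<open>B\<close> stays fixed while the sequence grows at its front, and the
  counter is the number of steps. Both lower bounds have this shape: one step changes the distance
  to \<open>B\<close> by at most one.\<close>

lemma reconf_seq_induct [consumes 1, case_names base step]:
  assumes "reconf_seq R G A l B"
    and "P B 0"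
    and "\<And>A A' n. \<lbrakk>D2DS G A; D2DS G A'; reconf_step R G A A'; P A' n\<rbrakk> \<Longrightarrow> P A (Suc n)"
  shows "P A (length l - 1)"
  using assms(1)
proof (induction l arbitrary: A)
  case Nil
  then show ?case by (simp add: reconf_seq_def)
next
  case (Cons D l)
  show ?case
  proof (cases l)
    case Nil
    then show ?thesis
      using Cons.prems assms(2) by (auto simp: reconf_seq_def)
  next
    case (Cons D' l')
    then have "reconf_seq R G D' l B" "D2DS G A" "D2DS G D'" "reconf_step R G A D'"
      using Cons.prems by (auto simp: reconf_seq_def)
    then have "P A (Suc (length l - 1))"
      using assms(3) Cons.IH by blast
    then show ?thesis
      using Cons by simp
  qed
qed

lemma reconf_seq_first_step:
  assumes "reconf_seq R G A l B" "A \<noteq> B"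
  obtains A' l' where "l = A # l'" "D2DS G A'" "reconf_step R G A A'" "reconf_seq R G A' l' B"
proof -
  obtain l' where l: "l = A # l'"
    using assms(1) by (cases l) (auto simp: reconf_seq_def)
  then obtain A' l'' where "l' = A' # l''"
    using assms by (cases l') (auto simp: reconf_seq_def)
  then show thesis
    using that[of l' A'] l assms(1) by (auto simp: reconf_seq_def)
qed

lemma opt_le_iff:
  "opt R G A B \<le> enat n \<longleftrightarrow> (\<exists>l. reconf_seq R G A l B \<and> length l - 1 \<le> n)"
  unfolding opt_def enat_INF_le_iff by simp

lemma opt_self: "D2DS G A \<Longrightarrow> opt R G A A \<le> enat n"
  unfolding opt_le_iff by (intro exI[of _ "[A]"]) (simp add: reconf_seq_def)

lemma opt_step:
  assumes "D2DS G A" "reconf_step R G A A'" "opt R G A' B \<le> enat n"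
  shows "opt R G A B \<le> enat (Suc n)"
proof -
  obtain l where l: "reconf_seq R G A' l B" "length l - 1 \<le> n"
    using assms(3) unfolding opt_le_iff by blast
  then show ?thesis
    unfolding opt_le_iff using reconf_seq_Cons[OF assms(1,2) l(1)]
    by (intro exI[of _ "A # l"]) auto
qed

lemma le_optI:
  assumes "\<And>l. reconf_seq R G A l B \<Longrightarrow> n \<le> length l - 1"
  shows "enat n \<le> opt R G A B"
  unfolding opt_def using assms by (intro INF_greatest) auto

lemma reconf_stepI:
  assumes "x \<in> A" "y \<notin> A" "R = TS \<Longrightarrow> (x, y) \<in> parcs G"
  shows "reconf_step R G A (insert y (A - {x}))"
  unfolding reconf_step_def using assms by (intro exI[of _ x] exI[of _ y]) auto

lemma reconf_stepE:
  assumes "reconf_step R G A A'"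
  obtains x y where "x \<in> A" "y \<notin> A" "A' = insert y (A - {x})" "R = TS \<Longrightarrow> (x, y) \<in> parcs G"
  using assms unfolding reconf_step_def
  by (metis Diff_Diff_Int Diff_iff Diff_insert_absorb Int_Diff Un_Diff_Int inf_commute
      insert_iff insert_is_Un singletonI)

lemma reconf_step_sym:
  assumes "sym (parcs G)" "reconf_step R G A A'"
  shows "reconf_step R G A' A"
  using assms unfolding reconf_step_def by (metis symD)

text \<open>Sequences can be reversed, so a last move into \<open>B\<close> may be treated as a
  first move out of \<open>B\<close>.\<close>

lemma opt_swap:
  assumes "sym (parcs G)" "opt R G A B \<le> enat n"
  shows "opt R G B A \<le> enat n"
proof -
  obtain l where l: "reconf_seq R G A l B" "length l - 1 \<le> n"
    using assms(2) unfolding opt_le_iff by blast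
  have "successively (reconf_step R G) (rev l)"
    using l(1) reconf_step_sym[OF assms(1)] unfolding reconf_seq_def successively_rev
    by (metis successively_mono)
  then have "reconf_seq R G B (rev l) A"
    using l(1) by (auto simp: reconf_seq_def hd_rev last_rev)
  with l(2) show ?thesis
    unfolding opt_le_iff by (intro exI[of _ "rev l"]) auto
qed

section \<open>Connected split graphs\<close>

text \<open>Connectivity enters only through \<open>has_neighbour\<close>. The second vertex
  \<open>b\<close> excludes the graph with a single vertex, whose vertex may lie in \<open>S\<close>
  and have no neighbour.\<close>

locale connected_split_graph = pair_graph G for G :: "'a pair_pre_digraph" +
  fixes K S :: "'a set"
  assumes verts_eq: "pverts G = K \<union> S"
    and disjoint: "K \<inter> S = {}"
    and clique: "\<lbrakk>u \<in> K; v \<in> K; u \<noteq> v\<rbrakk> \<Longrightarrow> (u, v) \<in> parcs G"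
    and independent: "\<lbrakk>u \<in> S; v \<in> S\<rbrakk> \<Longrightarrow> (u, v) \<notin> parcs G"
    and has_neighbour: "\<lbrakk>a \<in> S; b \<in> pverts G; a \<noteq> b\<rbrakk> \<Longrightarrow> \<exists>w\<in>K. (a, w) \<in> parcs G"

text \<open>A walk from \<open>a\<close> in \<open>S\<close> to another vertex begins with an arc,
  and the head of that arc lies in \<open>K\<close> because \<open>S\<close> is independent.\<close>

lemma connected_split_graphI:
  assumes "split_graph G K S" "Digraph_Component.connected (with_proj G)"
  shows "connected_split_graph G K S"
proof -
  interpret pair_graph G
    using assms(1) by (simp add: split_graph_def)
  note split = assms(1)[unfolded split_graph_def]
  show ?thesis
  proof unfold_locales
    fix a b assume ab: "a \<in> S" "b \<in> pverts G" "a \<noteq> b"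
    have "strongly_connected (with_proj G)"
      using symmetric_connected_imp_strongly_connected assms(2) pair_sym_arcs by blast
    then have "a \<rightarrow>\<^sup>*\<^bsub>with_proj G\<^esub> b"
      using ab split by (auto simp: strongly_connected_def)
    then obtain p where p: "awalk a p b"
      using reachable_awalk by blast
    then obtain e q where "p = e # q"
      using ab(3) by (cases p) (auto simp: awalk_simps)
    then have "(a, snd e) \<in> parcs G"
      using p by (cases e) (auto simp: awalk_simps)
    moreover from this have "snd e \<in> pverts G"
      using arc_snd_in_verts by fastforce
    ultimately show "\<exists>w\<in>K. (a, w) \<in> parcs G"
      using split ab(1) by blast
  qed (use split in auto)
qed

context connected_split_graph
begin

lemma sym_parcs: "sym (parcs G)"
  using pair_sym_arcs by (simp add: symmetric_def)

lemma parcs_sym: "(u, v) \<in> parcs G \<Longrightarrow> (v, u) \<in> parcs G"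
  using sym_parcs by (rule symD)

lemma parcs_neq: "(u, v) \<in> parcs G \<Longrightarrow> u \<noteq> v"
  using pair_no_loops by fastforce

lemma parcs_verts: "(u, v) \<in> parcs G \<Longrightarrow> u \<in> pverts G \<and> v \<in> pverts G"
  using arc_fst_in_verts arc_snd_in_verts by fastforce

lemma neighbour_in_K: "u \<in> S \<Longrightarrow> (u, v) \<in> parcs G \<Longrightarrow> v \<in> K"
  using independent parcs_verts verts_eq by blast

lemma split_graph: "split_graph G K S"
  unfolding split_graph_def
  using verts_eq disjoint clique independent pair_graph by auto

abbreviation d :: "'a \<Rightarrow> 'a \<Rightarrow> nat" where "d \<equiv> short_dist (parcs G)"

sublocale metric_matching d
  by unfold_locales (simp, rule short_dist_sym[OF sym_parcs], rule short_dist_triangle)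

text \<open>Each end reaches the clique in at most one arc, and one more arc at most joins the two
  clique vertices.\<close>

lemma gdist_le_3:
  assumes "u \<in> pverts G" "v \<in> pverts G"
  shows "gdist G u v \<le> enat 3"
proof -
  have *: "\<exists>w\<in>K. \<exists>p. awalk u p w \<and> length p \<le> 1"
    if uv: "u \<in> pverts G" "v \<in> pverts G" "u \<noteq> v" for u v
  proof (cases "u \<in> K")
    case True
    then show ?thesis
      using uv by (intro bexI[of _ u] exI[of _ "[]"]) (auto simp: awalk_simps)
  next
    case False
    then obtain w where "w \<in> K" "(u, w) \<in> parcs G"
      using has_neighbour[of u v] uv verts_eq by auto
    then show ?thesis
      using parcs_verts by (intro bexI[of _ w] exI[of _ "[(u, w)]"]) (auto simp: awalk_simps)
  qed
  show ?thesis
  proof (cases "u = v")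
    case True
    then show ?thesis
      unfolding gdist_le_iff using assms by (intro exI[of _ "[]"]) (auto simp: awalk_simps)
  next
    case False
    obtain w where w: "w \<in> K" "gdist G u w \<le> enat 1"
      using *[OF assms False] unfolding gdist_le_iff by blast
    obtain w' where w': "w' \<in> K" "gdist G v w' \<le> enat 1"
      using *[OF assms(2,1)] False unfolding gdist_le_iff by blast
    obtain p where p: "awalk u p w" "length p \<le> 1"
      using w unfolding gdist_le_iff by blast
    have "w' = v \<or> (w', v) \<in> parcs G"
      using w'(2) gdist_le_012(2)[OF assms(2), of w'] parcs_sym by blast
    then obtain q where q: "awalk w' q v" "length q \<le> 1"
      using gdist_le_012(2)[of w' v] w'(1) verts_eq unfolding gdist_le_iff by blast
    obtain r where r: "awalk w r w'" "length r \<le> 1"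
      using gdist_le_012(2)[of w w'] w(1) w'(1) clique verts_eq unfolding gdist_le_iff by blast
    have "awalk u (p @ r @ q) v"
      using p(1) q(1) r(1) by (metis awalk_appendI)
    then show ?thesis
      unfolding gdist_le_iff using p q r by (intro exI[of _ "p @ r @ q"]) auto
  qed
qed

text \<open>Both distances satisfy the same bounds \<open>n\<close>: for \<open>n\<close> at most 2
  by listing the walks, from 3 on because both are at most 3. Equality follows by using each value
  as a bound for the other.\<close>

lemma gdist_eq_short_dist:
  assumes "u \<in> pverts G" "v \<in> pverts G"
  shows "gdist G u v = enat (d u v)"
proof -
  have iff: "gdist G u v \<le> enat n \<longleftrightarrow> d u v \<le> n" for n
  proof -
    consider "n = 0" | "n = 1" | "n = 2" | "n \<ge> 3" by linarith
    then show ?thesis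
    proof cases
      case 4
      then have "gdist G u v \<le> enat n"
        using gdist_le_3[OF assms] by (meson enat_ord_simps(1) order_trans)
      moreover have "d u v \<le> n"
        using 4 by (simp add: short_dist_def)
      ultimately show ?thesis by simp
    qed (use assms gdist_le_012[OF assms(1), of v] in \<open>auto simp: short_dist_def\<close>)
  qed
  obtain n where n: "gdist G u v = enat n"
    using gdist_le_3[OF assms] by (cases "gdist G u v") auto
  show ?thesis
    using iff[of n] iff[of "d u v"] n by auto
qed

text \<open>A vertex of \<open>K\<close> is within distance 1 of \<open>u\<close>. A vertex of
  \<open>S\<close> other than \<open>u\<close> has a neighbour in \<open>K\<close>, which equals or
  is adjacent to \<open>u\<close>.\<close>

lemma D2DS_if_meets_clique:
  assumes "D \<subseteq> pverts G" "u \<in> D" "u \<in> K"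
  shows "D2DS G D"
  unfolding D2DS_def
proof (intro conjI ballI bexI)
  fix v assume v: "v \<in> pverts G"
  have "v = u \<or> (v, u) \<in> parcs G \<or> (\<exists>w. (v, w) \<in> parcs G \<and> (w, u) \<in> parcs G)"
    using v assms clique has_neighbour[of v u] verts_eq by blast
  then show "gdist G v u \<le> 2"
    using gdist_le_012(3)[OF v, of u] by (simp flip: numeral_eq_enat)
qed (use assms in auto)

text \<open>The graph is a star with centre \<open>u\<close>, so any two vertices are at distance at
  most 2.\<close>

lemma D2DS_if_clique_singleton:
  assumes "D \<subseteq> pverts G" "D \<noteq> {}" "K = {u}"
  shows "D2DS G D"
  unfolding D2DS_def
proof (intro conjI ballI)
  fix v assume v: "v \<in> pverts G"
  obtain x where x: "x \<in> D"
    using assms(2) by blast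
  have to_u: "(y, u) \<in> parcs G" if "y \<in> pverts G" "z \<in> pverts G" "y \<noteq> z" "y \<noteq> u" for y z
    using has_neighbour[of y z] that assms(3) verts_eq by auto
  have "v = x \<or> (v, x) \<in> parcs G \<or> (\<exists>w. (v, w) \<in> parcs G \<and> (w, x) \<in> parcs G)"
    using to_u[of v x] to_u[of x v] v x assms(1) parcs_sym by blast
  then show "\<exists>u\<in>D. gdist G v u \<le> 2"
    using x gdist_le_012(3)[OF v, of x] by (auto simp flip: numeral_eq_enat)
qed (use assms in auto)

section \<open>The sliding bound as the least cost of a matching\<close>

lemma Mstar_TS_le:
  assumes "matched d A B n" "A \<subseteq> pverts G" "B \<subseteq> pverts G"
  shows "Mstar_TS G A B \<le> enat n"
proof -
  obtain f where f: "bij_betw f A B" "n = (\<Sum>a\<in>A. d a (f a))"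
    using matched_imp_bij_betw assms(1) by metis
  have "(\<Sum>a\<in>A. gdist G a (f a)) = (\<Sum>a\<in>A. enat (d a (f a)))"
    using f(1) assms(2,3) by (intro sum.cong gdist_eq_short_dist) (auto simp: bij_betw_def)
  also have "\<dots> = enat n"
    unfolding f(2) by (simp flip: of_nat_eq_enat)
  finally show ?thesis
    unfolding Mstar_TS_def using f(1) by (intro INF_lower2[of f]) auto
qed

lemma Mstar_TS_attained:
  assumes "A \<subseteq> pverts G" "B \<subseteq> pverts G" "card A = card B"
  obtains n where "matched d A B n" "Mstar_TS G A B = enat n"
proof -
  have fin: "finite A" "finite B"
    using assms pair_finite_verts finite_subset by blast+
  let ?L = "(\<lambda>f. \<Sum>a\<in>A. gdist G a (f a)) ` {f. bij_betw f A B}"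
  have "?L \<noteq> {}"
    using finite_same_card_bij[OF fin assms(3)] by auto
  then have "Inf ?L \<in> ?L"
    by (rule enat_Inf_mem)
  then obtain f where f: "bij_betw f A B" "Mstar_TS G A B = (\<Sum>a\<in>A. gdist G a (f a))"
    unfolding Mstar_TS_def by auto
  have "(\<Sum>a\<in>A. gdist G a (f a)) = (\<Sum>a\<in>A. enat (d a (f a)))"
    using f(1) assms(1,2) by (intro sum.cong gdist_eq_short_dist) (auto simp: bij_betw_def)
  also have "\<dots> = enat (\<Sum>a\<in>A. d a (f a))"
    by (simp flip: of_nat_eq_enat)
  finally show thesis
    using that matched_bij_betw[OF fin(1) f(1)] f(2) by metis
qed

end

section \<open>Token sliding\<close>

context connected_split_graph
begin

text \<open>Going back along a slide from \<open>x\<close> to \<open>y\<close>, the token on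
  \<open>x\<close> inherits the partner of \<open>y\<close>. By the triangle inequality the cost
  grows by at most 1.\<close>

lemma Mstar_TS_le_opt:
  assumes "A \<subseteq> pverts G" "B \<subseteq> pverts G" "finite B"
  shows "Mstar_TS G A B \<le> opt TS G A B"
  unfolding opt_def
proof (rule INF_greatest)
  fix l assume "l \<in> {l. reconf_seq TS G A l B}"
  then have "reconf_seq TS G A l B" by simp
  then have "\<exists>n\<le>length l - 1. matched d A B n"
  proof (induction rule: reconf_seq_induct)
    case base
    have "matched d B B (\<Sum>b\<in>B. d b (id b))"
      using assms(3) by (intro matched_bij_betw) (auto simp: bij_betw_def)
    then show ?case by simp
  next
    case (step A A' n)
    then obtain k where k: "k \<le> n" "matched d A' B k" by blast
    obtain x y where xy: "x \<in> A" "y \<notin> A" "A' = insert y (A - {x})" "(x, y) \<in> parcs G"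
      using step(3) by (elim reconf_stepE) auto
    obtain b m where b: "b \<in> B" "matched d (A' - {y}) (B - {b}) m" "k = d y b + m"
      using matched_Diff[OF k(2), of y] xy(3) by blast
    have "A' - {y} = A - {x}"
      using xy by auto
    then have "matched d A B (d x b + m)"
      using matched_insert_Diff b(1,2) xy(1) by metis
    moreover have "d x b + m \<le> Suc n"
      using triangle[of x b y] short_dist_edge[OF xy(4)] b(3) k(1) by linarith
    ultimately show ?case by blast
  qed
  then show "Mstar_TS G A B \<le> enat (length l - 1)"
    using Mstar_TS_le assms(1,2) by (meson enat_ord_simps(1) order_trans)
qed

text \<open>A slide that pays for itself: the cost of the rest drops strictly, so an induction on
  the cost can continue. \<open>free_step B A n\<close> describes a final slide into
  \<open>B\<close>, read backwards.\<close>

definition free_step :: "'a set \<Rightarrow> 'a set \<Rightarrow> nat \<Rightarrow> bool" where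
  "free_step A B n \<longleftrightarrow>
     (\<exists>A' m. D2DS G A' \<and> reconf_step TS G A A' \<and> m < n \<and> matched d A' B m)"

text \<open>The token on \<open>a\<close> moves to the vacant vertex \<open>w\<close>, nearer to its
  target, and keeps that target; no other term of the cost changes.\<close>

lemma free_step_advance:
  assumes m: "matched d (A - {a}) (B - {b}) m" "d a b + m \<le> n" "a \<in> A" "b \<in> B"
    and "(a, w) \<in> parcs G" "w \<notin> A" "d w b < d a b" "D2DS G (insert w (A - {a}))"
  shows "free_step A B n"
proof -
  have "matched d (insert w (A - {a})) (insert b (B - {b})) (d w b + m)"
    using assms by (intro matched.insert) auto
  then have "matched d (insert w (A - {a})) B (d w b + m)"
    using m(4) by (simp add: insert_absorb)
  moreover have "reconf_step TS G A (insert w (A - {a}))"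
    using assms by (intro reconf_stepI)
  ultimately show ?thesis
    unfolding free_step_def using assms by (intro exI conjI) auto
qed

text \<open>If the path of \<open>a\<close> towards \<open>b\<close> is blocked by a token \<open>w\<close>, that token takes over
  the target \<open>b\<close> and \<open>a\<close> inherits the target of \<open>w\<close>.\<close>

lemma free_step_relay:
  assumes m: "matched d (A - {a}) (B - {b}) m" "d a b + m \<le> n" "a \<in> A" "b \<in> B"
    and w: "w \<in> A" "w \<noteq> a" "(w, b) \<in> parcs G" "b \<notin> A" "d a w < d a b"
    and D: "D2DS G (insert b (A - {w}))"
  shows "free_step A B n"
proof -
  obtain c m' where c: "c \<in> B - {b}" "matched d (A - {a} - {w}) (B - {b} - {c}) m'" "m = d w c + m'"
    using matched_Diff[OF m(1), of w] w by blast
  have "A - {a} - {w} = A - {w} - {a}" by blast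
  then have "matched d (A - {w}) (B - {b}) (d a c + m')"
    using c m(3) w(2) by (intro matched_insert_Diff) auto
  then have "matched d (insert b (A - {w})) (insert b (B - {b})) (d b b + (d a c + m'))"
    using w(4) by (intro matched.insert) auto
  then have "matched d (insert b (A - {w})) B (d a c + m')"
    using m(4) by (simp add: insert_absorb)
  moreover have "d a c + m' < n"
    using triangle[of a c w] c(3) m(2) w(5) by linarith
  moreover have "reconf_step TS G A (insert b (A - {w}))"
    using w by (intro reconf_stepI)
  ultimately show ?thesis
    unfolding free_step_def using D by blast
qed

text \<open>The partner \<open>a\<close> of \<open>b\<close> slides onto \<open>b\<close> if
  adjacent. Otherwise \<open>a\<close> lies in \<open>S\<close> and a clique neighbour
  \<open>w\<close> of \<open>a\<close> is halfway to \<open>b\<close>: if vacant, \<open>a\<close>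
  advances to \<open>w\<close>; if occupied, the token on \<open>w\<close> slides to
  \<open>b\<close>. Each time the new set contains the clique vertex \<open>b\<close> or
  \<open>w\<close>, so it dominates.\<close>

lemma free_step_target_in_clique:
  assumes M: "matched d A B n" and V: "A \<subseteq> pverts G" "B \<subseteq> pverts G"
    and b: "b \<in> B - A" "b \<in> K"
  shows "free_step A B n"
proof -
  obtain a m where am: "a \<in> A - B" "matched d (B - {b}) (A - {a}) m" "d b a + m \<le> n"
    using matched_keep_common[OF matched_swap[OF M] b(1)] by blast
  have m: "matched d (A - {a}) (B - {b}) m" "d a b + m \<le> n" "a \<in> A" "b \<in> B"
    using am matched_swap[OF am(2)] sym[of a b] b(1) by auto
  have "a \<noteq> b" using am b by auto
  show ?thesis
  proof (cases "(a, b) \<in> parcs G")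
    case True
    have "d b b < d a b"
      using \<open>a \<noteq> b\<close> by (simp add: short_dist_def)
    then show ?thesis
      using True b V by (intro free_step_advance[OF m, of b] D2DS_if_meets_clique[of _ b]) auto
  next
    case False
    then have "a \<in> S"
      using clique[of a b] \<open>a \<noteq> b\<close> b am V verts_eq by auto
    then obtain w where w: "w \<in> K" "(a, w) \<in> parcs G"
      using has_neighbour[of a b] \<open>a \<noteq> b\<close> b V by blast
    have wb: "w \<noteq> b" "w \<noteq> a"
      using w(2) False parcs_neq by auto
    then have "(w, b) \<in> parcs G"
      using clique w b by blast
    then have dist: "d a b = 2" "d a w = 1" "d w b = 1"
      using False w(2) \<open>a \<noteq> b\<close> wb by (auto simp: short_dist_def)
    show ?thesis
    proof (cases "w \<in> A")
      case True
      then show ?thesis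
        using b V wb \<open>(w, b) \<in> parcs G\<close> dist
        by (intro free_step_relay[OF m, of w] D2DS_if_meets_clique[of _ b]) auto
    next
      case False
      then show ?thesis
        using V w dist verts_eq
        by (intro free_step_advance[OF m, of w] D2DS_if_meets_clique[of _ w]) auto
    qed
  qed
qed

text \<open>A shortest path from \<open>a\<close> to \<open>b\<close> runs through clique vertices
  \<open>w\<close> and \<open>w'\<close>, possibly equal. Both must be occupied, or else
  \<open>a\<close> could advance to \<open>w\<close> or, backwards, \<open>b\<close> to
  \<open>w'\<close>. Relaying the token on \<open>w'\<close> to \<open>b\<close> can then fail only
  by losing domination, so \<open>w'\<close> carries the only clique token and is not all of
  \<open>K\<close>. Hence \<open>w = w'\<close> is the hub \<open>u\<close>.\<close>

lemma free_step_independent: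
  assumes V: "A \<subseteq> pverts G" "B \<subseteq> pverts G" and S: "A - B \<subseteq> S" "B - A \<subseteq> S"
    and m: "matched d (A - {a}) (B - {b}) m" "d a b + m \<le> n" and ab: "a \<in> A - B" "b \<in> B - A"
    and no_free: "\<not> free_step A B n" "\<not> free_step B A n"
  obtains u where "A \<inter> K = {u}" "(a, u) \<in> parcs G" "(b, u) \<in> parcs G" "K \<noteq> {u}"
proof -
  have "a \<noteq> b" "a \<in> S" "b \<in> S" "(a, b) \<notin> parcs G"
    using ab S independent by auto
  have K: "A \<inter> K = B \<inter> K"
    using S disjoint by blast
  have rev: "matched d (B - {b}) (A - {a}) m" "d b a + m \<le> n"
    using matched_swap[OF m(1)] m(2) sym[of a b] by auto
  \<comment> \<open>A common neighbour of \<open>a\<close> and \<open>b\<close>, if there is one,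
    serves as both \<open>w\<close> and \<open>w'\<close>. So \<open>w\<close> and \<open>w'\<close>
    differ only when \<open>a\<close> and \<open>b\<close> are at distance 3.\<close>
  obtain w w' where w: "w \<in> K" "w' \<in> K" "(a, w) \<in> parcs G" "(b, w') \<in> parcs G"
    and eq: "\<And>v. (a, v) \<in> parcs G \<Longrightarrow> (v, b) \<in> parcs G \<Longrightarrow> w = w'"
  proof (cases "\<exists>v. (a, v) \<in> parcs G \<and> (v, b) \<in> parcs G")
    case True
    then obtain v where v: "(a, v) \<in> parcs G" "(v, b) \<in> parcs G" by blast
    then show thesis
      using that[of v v] neighbour_in_K[OF \<open>a \<in> S\<close>] parcs_sym by blast
  next
    case False
    then show thesis
      using that has_neighbour[of a b] has_neighbour[of b a] \<open>a \<noteq> b\<close> \<open>a \<in> S\<close> \<open>b \<in> S\<close> verts_eq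
      by blast
  qed
  have not_ab: "w \<noteq> a" "w \<noteq> b" "w' \<noteq> a" "w' \<noteq> b"
    using w \<open>a \<in> S\<close> \<open>b \<in> S\<close> disjoint by auto
  have near: "d w b < d a b" "d w' a < d b a"
  proof -
    have "d a b = (if w = w' then 2 else 3)"
    proof (cases "w = w'")
      case True
      then show ?thesis
        using \<open>a \<noteq> b\<close> \<open>(a, b) \<notin> parcs G\<close> w(3) parcs_sym[OF w(4)] by (auto simp: short_dist_def)
    next
      case False
      then have "\<nexists>v. (a, v) \<in> parcs G \<and> (v, b) \<in> parcs G"
        using eq by blast
      then show ?thesis
        using \<open>a \<noteq> b\<close> \<open>(a, b) \<notin> parcs G\<close> False by (simp add: short_dist_def)
    qed
    moreover have "d w w' = (if w = w' then 0 else 1)"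
      using clique w by (auto simp: short_dist_def)
    moreover have "d w' b \<le> 1" "d w a \<le> 1"
      using w(3,4)[THEN parcs_sym] short_dist_edge by metis+
    ultimately show "d w b < d a b" "d w' a < d b a"
      using triangle[of w b w'] triangle[of w' a w] sym[of w w'] sym[of a b]
      by (cases "w = w'"; simp)+
  qed
  have "w \<in> A"
  proof (rule ccontr)
    assume "w \<notin> A"
    then have "free_step A B n"
      using ab w near V verts_eq
      by (intro free_step_advance[OF m, of w] D2DS_if_meets_clique[of _ w]) auto
    with no_free show False by blast
  qed
  have "w' \<in> B"
  proof (rule ccontr)
    assume "w' \<notin> B"
    then have "free_step B A n"
      using ab w near V verts_eq
      by (intro free_step_advance[OF rev, of w'] D2DS_if_meets_clique[of _ w']) auto
    with no_free show False by blast
  qed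
  \<comment> \<open>All moving tokens start and end in \<open>S\<close>, so \<open>A\<close> and
    \<open>B\<close> have the same clique tokens.\<close>
  then have "w' \<in> A"
    using K w by blast
  have not_D2DS: "\<not> D2DS G (insert b (A - {w'}))"
  proof
    assume "D2DS G (insert b (A - {w'}))"
    then have "free_step A B n"
      using \<open>w' \<in> A\<close> ab near not_ab sym[of a w'] sym[of a b] parcs_sym[OF w(4)]
      by (intro free_step_relay[OF m, of w']) auto
    with no_free show False by blast
  qed
  have only: "v = w'" if "v \<in> A" "v \<in> K" for v
    using not_D2DS D2DS_if_meets_clique[of "insert b (A - {w'})" v] that V ab by blast
  show thesis
  proof (rule that[of w'])
    show "A \<inter> K = {w'}"
      using only \<open>w' \<in> A\<close> w(2) by blast
    show "(a, w') \<in> parcs G" "(b, w') \<in> parcs G"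
      using only[OF \<open>w \<in> A\<close> w(1)] w(3,4) by simp_all
    show "K \<noteq> {w'}"
      using not_D2DS D2DS_if_clique_singleton[of "insert b (A - {w'})" w'] V ab by blast
  qed
qed

text \<open>The token on \<open>v\<close> stays put and keeps every intermediate set dominating.
  Every start in \<open>X\<close> and every target in \<open>Y\<close> is adjacent to the vacant
  \<open>u\<close>, so any pairing works and each token needs two slides.\<close>

lemma opt_TS_through_hub:
  assumes "finite X" "card X = card Y" "finite Y" "X \<inter> Y = {}"
    and "P \<inter> (X \<union> Y) = {}" "P \<union> X \<union> Y \<subseteq> pverts G"
    and "v \<in> P" "v \<in> K" "u \<notin> P \<union> X \<union> Y" "\<And>x. x \<in> X \<union> Y \<Longrightarrow> (x, u) \<in> parcs G"
  shows "opt TS G (P \<union> X) (P \<union> Y) \<le> enat (2 * card X)"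
  using assms
proof (induction X arbitrary: P Y)
  case empty
  then have "Y = {}" by simp
  then show ?case
    using empty opt_self[OF D2DS_if_meets_clique[of P v]] by simp
next
  case (insert x X)
  then obtain y where y: "y \<in> Y"
    by (metis card_eq_0_iff ex_in_conv finite_insert insert_not_empty)
  \<comment> \<open>A token that has arrived counts as parked, so the induction must generalise over
    \<open>P\<close>.\<close>
  let ?P = "insert y P" and ?Y = "Y - {y}"
  have "opt TS G (?P \<union> X) (?P \<union> ?Y) \<le> enat (2 * card X)"
  proof (rule insert.IH)
    show "card X = card ?Y"
      using insert.prems(1,2) insert.hyps y by simp
  qed (use insert.prems insert.hyps y in auto)
  moreover have "?P \<union> ?Y = P \<union> Y"
    using y by auto
  ultimately have rest: "opt TS G (?P \<union> X) (P \<union> Y) \<le> enat (2 * card X)"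
    by simp
  let ?M = "insert u (P \<union> X)"
  have u: "u \<in> pverts G"
    using insert.prems(9)[of x] parcs_verts by blast
  have "reconf_step TS G (P \<union> insert x X) (insert u (P \<union> insert x X - {x}))"
    using insert.prems by (intro reconf_stepI) auto
  moreover have "insert u (P \<union> insert x X - {x}) = ?M"
    using insert.prems insert.hyps by auto
  ultimately have step1: "reconf_step TS G (P \<union> insert x X) ?M"
    by simp
  have "reconf_step TS G ?M (insert y (?M - {u}))"
    using insert.prems(3-8) y parcs_sym[OF insert.prems(9)[of y]] by (intro reconf_stepI) auto
  moreover have "insert y (?M - {u}) = ?P \<union> X"
    using insert.prems by auto
  ultimately have step2: "reconf_step TS G ?M (?P \<union> X)"
    by simp
  have "opt TS G ?M (P \<union> Y) \<le> enat (Suc (2 * card X))"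
    using insert.prems u by (intro opt_step[OF _ step2 rest] D2DS_if_meets_clique[of _ v]) auto
  then have "opt TS G (P \<union> insert x X) (P \<union> Y) \<le> enat (Suc (Suc (2 * card X)))"
    using insert.prems by (intro opt_step[OF _ step1] D2DS_if_meets_clique[of _ v]) auto
  then show ?case
    using insert.hyps by simp
qed

text \<open>Sliding the token on \<open>u\<close> to another clique vertex \<open>v\<close> frees
  the hub, and \<open>v\<close> takes over the domination. The two extra slides are \<open>u\<close>
  to \<open>v\<close> at the start and \<open>v\<close> to \<open>u\<close> at the end; the latter
  is obtained as a first slide from \<open>B\<close>.\<close>

lemma opt_TS_single_hub:
  assumes V: "A \<subseteq> pverts G" "B \<subseteq> pverts G" and card: "card A = card B"
    and S: "A - B \<subseteq> S" "B - A \<subseteq> S"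
    and u: "A \<inter> K = {u}" "K \<noteq> {u}" "\<And>x. x \<in> sym_diff A B \<Longrightarrow> (x, u) \<in> parcs G"
  shows "opt TS G A B \<le> enat (2 * card (A - B) + 2)"
proof -
  have fin: "finite A" "finite B"
    using V pair_finite_verts finite_subset by blast+
  have K: "A \<inter> K = B \<inter> K"
    using S disjoint by blast
  then have uAB: "u \<in> A" "u \<in> B" "u \<in> K"
    using u(1) by blast+
  obtain v where v: "v \<in> K" "v \<noteq> u"
    using u by blast
  then have vAB: "v \<notin> A" "v \<notin> B"
    using u(1) K by blast+
  let ?P = "insert v (A \<inter> B - {u})"
  have "card (A - B) = card (B - A)"
    using card fin by (simp add: card_Diff_subset_Int Int_commute)
  then have "opt TS G (?P \<union> (A - B)) (?P \<union> (B - A)) \<le> enat (2 * card (A - B))"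
    using V fin v vAB u uAB verts_eq by (intro opt_TS_through_hub[of _ _ _ v u]) auto
  moreover have "?P \<union> (A - B) = insert v (A - {u})" "?P \<union> (B - A) = insert v (B - {u})"
    using uAB by auto
  ultimately have mid: "opt TS G (insert v (A - {u})) (insert v (B - {u})) \<le> enat (2 * card (A - B))"
    by simp
  have DA: "D2DS G A" "D2DS G B"
    using V uAB D2DS_if_meets_clique by blast+
  have stepA: "reconf_step TS G A (insert v (A - {u}))"
    and stepB: "reconf_step TS G B (insert v (B - {u}))"
    using clique uAB v vAB by (auto intro!: reconf_stepI)
  have "opt TS G A (insert v (B - {u})) \<le> enat (Suc (2 * card (A - B)))"
    by (rule opt_step[OF DA(1) stepA mid])
  from opt_step[OF DA(2) stepB opt_swap[OF sym_parcs this]]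
  have "opt TS G B A \<le> enat (2 * card (A - B) + 2)"
    by simp
  then show ?thesis
    by (rule opt_swap[OF sym_parcs])
qed

text \<open>Strong induction on the cost. Every free slide, at either end, is paid for by the drop
  in cost, so the surplus 2 is passed on unspent. It is needed at most once, when no free slide is
  left and the sets still differ.\<close>

lemma opt_TS_le_matched:
  assumes "matched d A B n" "D2DS G A" "D2DS G B"
  shows "opt TS G A B \<le> enat (n + 2)"
  using assms
proof (induction n arbitrary: A B rule: less_induct)
  case (less n)
  note M = less.prems(1)
  have V: "A \<subseteq> pverts G" "B \<subseteq> pverts G"
    using less.prems by (auto simp: D2DS_def)
  have step: "opt TS G A B \<le> enat (n + 2)"
    if fs: "free_step A B n" "D2DS G A" "D2DS G B" for A B
  proof -
    obtain A' m where "D2DS G A'" "reconf_step TS G A A'" "m < n" "matched d A' B m"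
      using fs(1) unfolding free_step_def by blast
    then have "opt TS G A B \<le> enat (Suc (m + 2))"
      using less.IH opt_step fs by metis
    moreover have "enat (Suc (m + 2)) \<le> enat (n + 2)"
      using \<open>m < n\<close> by simp
    ultimately show ?thesis by (rule order_trans)
  qed
  have stepr: "opt TS G A B \<le> enat (n + 2)" if "free_step B A n"
    using step[OF that] less.prems opt_swap[OF sym_parcs] by blast
  show ?case
  proof (cases "free_step A B n \<or> free_step B A n")
    case True
    then show ?thesis
      using step less.prems stepr by blast
  next
    case False
    then have no_free: "\<not> free_step A B n" "\<not> free_step B A n" by auto
    have S: "B - A \<subseteq> S" "A - B \<subseteq> S"
      using no_free free_step_target_in_clique[OF M] free_step_target_in_clique[OF matched_swap[OF M]]
        V verts_eq by blast+
    have K: "A \<inter> K = B \<inter> K"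
      using S disjoint by blast
    \<comment> \<open>The hub is found separately for each moving token, but
      \<open>A \<inter> K = {u}\<close> makes it the same for all of them.\<close>
    have hub: "\<exists>u. A \<inter> K = {u} \<and> K \<noteq> {u} \<and> (a, u) \<in> parcs G" if "a \<in> sym_diff A B" for a
      using that
    proof
      assume a: "a \<in> A - B"
      obtain b m where "b \<in> B - A" "matched d (A - {a}) (B - {b}) m" "d a b + m \<le> n"
        using matched_keep_common[OF M a] by blast
      then show ?thesis
        using free_step_independent[OF V S(2,1) _ _ a _ no_free] by metis
    next
      assume a: "a \<in> B - A"
      obtain b m where "b \<in> A - B" "matched d (B - {a}) (A - {b}) m" "d a b + m \<le> n"
        using matched_keep_common[OF matched_swap[OF M] a] by blast
      then show ?thesis
        using free_step_independent[OF V(2,1) S(1,2) _ _ a _ no_free(2,1)] K by metis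
    qed
    show ?thesis
    proof (cases "A = B")
      case True
      then show ?thesis
        using opt_self less.prems by blast
    next
      case False
      then obtain a where "a \<in> sym_diff A B" by blast
      from hub[OF this] obtain u where u: "A \<inter> K = {u}" "K \<noteq> {u}"
        by (elim exE conjE)
      have "(x, u) \<in> parcs G" if x: "x \<in> sym_diff A B" for x
      proof -
        from hub[OF x] obtain u' where "A \<inter> K = {u'}" "(x, u') \<in> parcs G"
          by (elim exE conjE)
        then show ?thesis using u(1) by simp
      qed
      then have le: "opt TS G A B \<le> enat (2 * card (A - B) + 2)"
        using V S u matched_finite(3)[OF M] by (intro opt_TS_single_hub) auto
      obtain m where m: "matched d (A - B) (B - A) m" "m \<le> n"
        using matched_Diff_Diff[OF M] by blast
      \<comment> \<open>Distinct independent vertices are at distance at least 2, so routing through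
        the hub costs no more than the matching does.\<close>
      have "2 * card (A - B) \<le> m"
      proof (rule matched_ge[OF m(1)])
        fix a b assume "a \<in> A - B" "b \<in> B - A"
        then have "a \<noteq> b" "(a, b) \<notin> parcs G"
          using S independent by blast+
        then show "2 \<le> d a b"
          by (simp add: short_dist_def)
      qed
      then have "enat (2 * card (A - B) + 2) \<le> enat (n + 2)"
        using m(2) by simp
      with le show ?thesis by (rule order_trans)
    qed
  qed
qed

lemma opt_TS_le_Mstar:
  assumes "D2DS G A" "D2DS G B" "card A = card B"
  shows "opt TS G A B \<le> Mstar_TS G A B + 2"
proof -
  obtain n where "matched d A B n" "Mstar_TS G A B = enat n"
    using Mstar_TS_attained assms by (metis D2DS_def)
  then show ?thesis
    using opt_TS_le_matched[OF _ assms(1,2)] by (metis numeral_eq_enat plus_enat_simps(1))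
qed

end

section \<open>Token jumping\<close>

lemma Mstar_TJ_eq:
  assumes "finite A" "finite B" "card A = card B"
  shows "Mstar_TJ G A B = enat (card (A - B))"
proof -
  have "card (sym_diff A B) = card (A - B) + card (B - A)"
    using assms by (intro card_Un_disjoint) auto
  moreover have "card (A - B) = card (B - A)"
    using assms by (simp add: card_Diff_subset_Int Int_commute)
  ultimately show ?thesis
    by (simp add: Mstar_TJ_def)
qed

lemma card_exchange:
  assumes "finite A" "x \<in> A" "y \<notin> A"
  shows "card (insert y (A - {x})) = card A"
  using assms card_Suc_Diff1[of A x] by simp

context connected_split_graph
begin

lemma D2DS_finite: "D2DS G A \<Longrightarrow> finite A"
  using finite_subset[OF _ pair_finite_verts] by (auto simp: D2DS_def)

text \<open>A jump removes only one token from the current set, so the number of tokens outside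
  \<open>B\<close> drops by at most one.\<close>

lemma Mstar_TJ_le_opt:
  assumes "D2DS G A" "D2DS G B" "card A = card B"
  shows "Mstar_TJ G A B \<le> opt TJ G A B"
  unfolding Mstar_TJ_eq[OF assms(1,2)[THEN D2DS_finite] assms(3)]
proof (rule le_optI)
  fix l assume "reconf_seq TJ G A l B"
  then show "card (A - B) \<le> length l - 1"
  proof (induction rule: reconf_seq_induct)
    case (step A A' n)
    obtain x y where "A' = insert y (A - {x})"
      using step(3) by (elim reconf_stepE)
    then have "A - B \<subseteq> insert x (A' - B)"
      by auto
    then have "card (A - B) \<le> card (insert x (A' - B))"
      using D2DS_finite step(2) by (intro card_mono) auto
    also have "\<dots> \<le> Suc (card (A' - B))"
      by (rule card_insert_le_m1) simp_all
    finally show ?case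
      using step(4) by simp
  qed simp
qed

text \<open>The token on \<open>u\<close> never moves and keeps all sets dominating, so the other
  tokens can be exchanged in any order.\<close>

lemma opt_TJ_common_clique_vertex:
  assumes "A \<subseteq> pverts G" "B \<subseteq> pverts G" "card A = card B" "u \<in> A" "u \<in> B" "u \<in> K"
  shows "opt TJ G A B \<le> enat (card (A - B))"
  using assms
proof (induction "card (A - B)" arbitrary: A)
  case 0
  have fin: "finite A" "finite B"
    using 0 pair_finite_verts finite_subset by blast+
  then have "A \<subseteq> B"
    using 0 by simp
  then have "A = B"
    using fin 0 by (simp add: card_subset_eq)
  then show ?case
    using 0 opt_self D2DS_if_meets_clique by blast
next
  case (Suc n)
  have fin: "finite A" "finite B"
    using Suc pair_finite_verts finite_subset by blast+
  then have "card (B - A) = card (A - B)"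
    using Suc by (simp add: card_Diff_subset_Int Int_commute)
  then obtain x y where xy: "x \<in> A - B" "y \<in> B - A"
    using Suc.hyps(2) by (metis card.empty ex_in_conv nat.distinct(1))
  let ?A = "insert y (A - {x})"
  have "card ?A = card A"
    using card_exchange[of A x y] fin xy by blast
  moreover have "?A - B = A - B - {x}"
    using xy by auto
  then have "card (?A - B) = n"
    using Suc.hyps(2) xy by simp
  ultimately have "opt TJ G ?A B \<le> enat n"
    using Suc.hyps(1)[of ?A] Suc.prems xy by auto
  then have "opt TJ G A B \<le> enat (Suc n)"
    using Suc.prems xy
    by (intro opt_step[of _ _ _ ?A] reconf_stepI D2DS_if_meets_clique[of _ u]) auto
  then show ?case
    using Suc.hyps(2) by simp
qed

text \<open>If \<open>u\<close> has to be left, its token jumps last. All other exchanges lead to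
  \<open>B\<close> with one new vertex \<open>y\<close> replaced by \<open>u\<close>, and the final
  jump goes from \<open>u\<close> to \<open>y\<close>.\<close>

lemma opt_TJ_meets_clique:
  assumes D: "D2DS G A" "D2DS G B" "card A = card B" and u: "u \<in> A" "u \<in> K"
  shows "opt TJ G A B \<le> enat (card (A - B))"
proof (cases "u \<in> B")
  case True
  then show ?thesis
    using assms by (intro opt_TJ_common_clique_vertex) (auto simp: D2DS_def)
next
  case False
  have fin: "finite A" "finite B"
    using D D2DS_finite by auto
  then have "card (B - A) = card (A - B)"
    using D by (simp add: card_Diff_subset_Int Int_commute)
  moreover have pos: "card (A - B) \<noteq> 0"
    using u False fin by auto
  ultimately obtain y where y: "y \<in> B - A"
    by (metis card.empty ex_in_conv)
  let ?B = "insert u (B - {y})"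
  have "opt TJ G A ?B \<le> enat (card (A - ?B))"
    using D u y False fin card_exchange[of B y u]
    by (intro opt_TJ_common_clique_vertex[of _ _ u]) (auto simp: D2DS_def)
  moreover have "A - ?B = A - B - {u}"
    using y by auto
  \<comment> \<open>The truncated subtraction is exact because of \<open>pos\<close>.\<close>
  ultimately have "opt TJ G A ?B \<le> enat (card (A - B) - 1)"
    using u False by simp
  then have "opt TJ G B A \<le> enat (Suc (card (A - B) - 1))"
    using D y False by (intro opt_step[of _ _ _ ?B] opt_swap[OF sym_parcs, of _ A] reconf_stepI) auto
  then show ?thesis
    using pos opt_swap[OF sym_parcs] by auto
qed

text \<open>The extra jump is spent only if neither set meets \<open>K\<close>. Then a token on some
  \<open>x\<close> outside \<open>B\<close> jumps to a clique neighbour \<open>w\<close> of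
  \<open>x\<close>. As \<open>w\<close> is not in \<open>B\<close> either, the number of misplaced
  tokens stays the same.\<close>

lemma opt_TJ_le_Mstar:
  assumes D: "D2DS G A" "D2DS G B" "card A = card B"
  shows "opt TJ G A B \<le> Mstar_TJ G A B + 1"
proof -
  have fin: "finite A" "finite B" and V: "A \<subseteq> pverts G" "B \<subseteq> pverts G"
    using D D2DS_finite by (auto simp: D2DS_def)
  have "opt TJ G A B \<le> enat (Suc (card (A - B)))"
  proof (cases "A = B")
    case True
    then show ?thesis
      using opt_self D by blast
  next
    case False
    have card_eq: "card (B - A) = card (A - B)"
      using D fin by (simp add: card_Diff_subset_Int Int_commute)
    have "A - B \<noteq> {}"
    proof
      assume "A - B = {}"
      then have "A \<subseteq> B" by blast
      then show False
        using False fin D card_subset_eq by blast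
    qed
    then obtain x where x: "x \<in> A - B" by blast
    have le_Suc: "enat (card (A - B)) \<le> enat (Suc (card (A - B)))"
      by simp
    consider u where "u \<in> A" "u \<in> K" | u where "u \<in> B" "u \<in> K" | "A \<inter> K = {}" "B \<inter> K = {}"
      by blast
    then show ?thesis
    proof cases
      case 1
      then show ?thesis
        using opt_TJ_meets_clique[OF D] le_Suc order_trans by blast
    next
      case 2
      then have "opt TJ G B A \<le> enat (card (B - A))"
        using opt_TJ_meets_clique[of B A] D by auto
      then show ?thesis
        using opt_swap[OF sym_parcs] card_eq le_Suc order_trans by metis
    next
      case 3
      obtain y where "y \<in> B"
        using D fin x by (metis DiffD1 card_eq_0_iff ex_in_conv)
      then obtain w where w: "w \<in> K" "(x, w) \<in> parcs G"
        using has_neighbour[of x y] x V 3 verts_eq by blast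
      let ?A = "insert w (A - {x})"
      have wAB: "w \<notin> A" "w \<notin> B"
        using 3 w by auto
      have DA: "D2DS G ?A"
        using V w verts_eq by (intro D2DS_if_meets_clique[of _ w]) auto
      have "card ?A = card B"
        using D(3) card_exchange[of A x w] fin x wAB by simp
      then have "opt TJ G ?A B \<le> enat (card (?A - B))"
        using DA D w by (intro opt_TJ_meets_clique[of _ _ w]) auto
      moreover have "card (?A - B) = card (A - B)"
      proof -
        have "?A - B = insert w (A - B - {x})"
          using wAB by auto
        then show ?thesis
          using card_exchange[of "A - B" x w] fin x wAB by simp
      qed
      ultimately show ?thesis
        using D x wAB by (intro opt_step[of _ _ _ ?A] reconf_stepI) auto
    qed
  qed
  then show ?thesis
    using Mstar_TJ_eq[OF fin D(3)] by (simp add: one_enat_def)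
qed

section \<open>Connectivity and a domination test for concrete instances\<close>

lemma connected:
  assumes "pverts G \<noteq> {}"
  shows "Digraph_Component.connected (with_proj G)"
proof -
  have "u \<rightarrow>\<^sup>*\<^bsub>with_proj (mk_symmetric (with_proj G))\<^esub> v" if "u \<in> pverts G" "v \<in> pverts G" for u v
    using gdist_le_3[OF that] reachable_mk_symmetricI reachable_awalk
    unfolding gdist_le_iff by blast
  then show ?thesis
    using assms by (auto simp: connected_def strongly_connected_def)
qed

text \<open>Clique vertices are dominated automatically, through a clique neighbour of any token.
  Two distinct independent vertices are within distance 2 exactly if they have a common neighbour in
  \<open>K\<close>. On a concrete graph this leaves a finite check.\<close>

lemma D2DS_independent_iff:
  assumes "D \<subseteq> S" "D \<noteq> {}"
  shows "D2DS G D \<longleftrightarrow>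
    (\<forall>v\<in>S. v \<in> D \<or> (\<exists>w\<in>K. (v, w) \<in> parcs G \<and> (\<exists>u\<in>D. (w, u) \<in> parcs G)))"
proof -
  have le2: "gdist G v u \<le> 2 \<longleftrightarrow>
      v = u \<or> (v, u) \<in> parcs G \<or> (\<exists>w. (v, w) \<in> parcs G \<and> (w, u) \<in> parcs G)"
    if "v \<in> pverts G" for u v
    using gdist_le_012(3)[OF that, of u] by (simp flip: numeral_eq_enat)
  have K: "\<exists>u\<in>D. gdist G v u \<le> 2" if v: "v \<in> K" for v
  proof -
    obtain u where u: "u \<in> D" using assms by blast
    then obtain w where "w \<in> K" "(u, w) \<in> parcs G"
      using has_neighbour[of u v] v assms(1) verts_eq disjoint by blast
    then have "gdist G v u \<le> 2"
      using le2[of v u] clique[of v w] v verts_eq parcs_sym by blast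
    then show ?thesis using u by blast
  qed
  have S: "(\<exists>u\<in>D. gdist G v u \<le> 2) \<longleftrightarrow>
      v \<in> D \<or> (\<exists>w\<in>K. (v, w) \<in> parcs G \<and> (\<exists>u\<in>D. (w, u) \<in> parcs G))" if v: "v \<in> S" for v
  proof -
    have "gdist G v u \<le> 2 \<longleftrightarrow> v = u \<or> (\<exists>w\<in>K. (v, w) \<in> parcs G \<and> (w, u) \<in> parcs G)" if "u \<in> D" for u
    proof -
      have "(v, u) \<notin> parcs G" "v \<in> pverts G"
        using that v independent assms(1) verts_eq by auto
      then show ?thesis
        using le2[of v u] neighbour_in_K[OF v] by (metis (no_types))
    qed
    then show ?thesis by blast
  qed
  show ?thesis
    unfolding D2DS_def verts_eq ball_Un using K S assms(1) by (simp add: le_supI2)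
qed

end

section \<open>Tight instances\<close>

definition incidence_split_graph ::
    "'a set \<Rightarrow> 'a set \<Rightarrow> ('a \<times> 'a) set \<Rightarrow> 'a pair_pre_digraph" where
  "incidence_split_graph K S H = \<lparr>pverts = K \<union> S, parcs = H \<union> H\<inverse> \<union> (K \<times> K - Id)\<rparr>"

lemma connected_split_graph_incidence:
  assumes H: "H \<subseteq> S \<times> K" "S \<subseteq> Domain H" and "K \<inter> S = {}" "finite K" "finite S"
  shows "connected_split_graph (incidence_split_graph K S H) K S"
proof -
  have fin: "finite H"
    using finite_subset[OF H(1)] assms(4,5) by simp
  show ?thesis
    unfolding incidence_split_graph_def using assms fin
    by unfold_locales (auto 0 3 simp: symmetric_def sym_def)
qed

section \<open>Tight instance for sliding\<close>

definition TS_graph :: "nat pair_pre_digraph" where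
  "TS_graph = incidence_split_graph {0, 1} {2, 3, 4} {(2, 0), (3, 0), (4, 1)}"

interpretation TS_graph: connected_split_graph TS_graph "{0, 1}" "{2, 3, 4}"
  unfolding TS_graph_def by (rule connected_split_graph_incidence) auto

lemma TS_graph_simps:
  "pverts TS_graph = {0, 1, 2, 3, 4}"
  "parcs TS_graph = {(0, 1), (1, 0), (0, 2), (2, 0), (0, 3), (3, 0), (1, 4), (4, 1)}"
  by (auto simp: TS_graph_def incidence_split_graph_def)

text \<open>The hub 0 is occupied and blocks the way from 2 to 3, while sliding its token to 3 would
  leave the pendant vertex 4 undominated. So the first slide must lead to \<open>{1, 2}\<close> and,
  symmetrically, the last one must start at \<open>{1, 3}\<close>. These sets are not one slide
  apart.\<close>

lemma TS_graph_opt: "4 \<le> opt TS TS_graph {0, 2} {0, 3}"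
proof -
  note arcs = TS_graph_simps
  have "\<not> D2DS TS_graph {2, 3}"
    by (subst TS_graph.D2DS_independent_iff) (auto simp: arcs)
  then have first: "D = {1, 2}" if "reconf_step TS TS_graph {0, 2} D" "D2DS TS_graph D" for D
    using that by (elim reconf_stepE) (auto simp: arcs insert_commute)
  have last: "D = {1, 3}" if "reconf_step TS TS_graph D {0, 3}" "D2DS TS_graph D" for D
  proof -
    have "reconf_step TS TS_graph {0, 3} D"
      using that(1) by (rule reconf_step_sym[OF TS_graph.sym_parcs])
    then show ?thesis
      using \<open>\<not> D2DS TS_graph {2, 3}\<close> that(2)
      by (elim reconf_stepE) (auto simp: arcs insert_commute)
  qed
  have mid: "\<not> reconf_step TS TS_graph {1, 2} {1, 3}"
  proof -
    have "{1, 2} - {1, 3} = {2 :: nat}" "{1, 3} - {1, 2} = {3 :: nat}" by auto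
    then show ?thesis by (simp add: reconf_step_def arcs)
  qed
  have "enat 4 \<le> opt TS TS_graph {0, 2} {0, 3}"
  proof (rule le_optI)
    fix l assume l: "reconf_seq TS TS_graph {0, 2} l {0, 3}"
    have "{0, 2} \<noteq> {0, 3 :: nat}"
      by (simp add: doubleton_eq_iff)
    then obtain D1 l1 where 1: "l = {0, 2} # l1" "D2DS TS_graph D1"
        "reconf_step TS TS_graph {0, 2} D1" "reconf_seq TS TS_graph D1 l1 {0, 3}"
      using reconf_seq_first_step[OF l] by metis
    have D1: "D1 = {1, 2}"
      using first 1 by blast
    then have "D1 \<noteq> {0, 3}"
      by (simp add: doubleton_eq_iff)
    then obtain D2 l2 where 2: "l1 = D1 # l2" "D2DS TS_graph D2"
        "reconf_step TS TS_graph D1 D2" "reconf_seq TS TS_graph D2 l2 {0, 3}"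
      using reconf_seq_first_step[OF 1(4)] by metis
    have "D2 \<noteq> {0, 3}"
    proof
      assume "D2 = {0, 3}"
      then have "D1 = {1, 3}"
        using last 2(3) 1(2) by simp
      then show False
        using D1 by (simp add: doubleton_eq_iff)
    qed
    then obtain D3 l3 where 3: "l2 = D2 # l3" "D2DS TS_graph D3"
        "reconf_step TS TS_graph D2 D3" "reconf_seq TS TS_graph D3 l3 {0, 3}"
      using reconf_seq_first_step[OF 2(4)] by metis
    have "D3 \<noteq> {0, 3}"
      using last[of D2] 3(3) 2(2,3) mid D1 by auto
    then obtain D4 l4 where "l3 = D3 # l4" "reconf_seq TS TS_graph D4 l4 {0, 3}"
      using reconf_seq_first_step[OF 3(4)] by metis
    then show "4 \<le> length l - 1"
      using 1(1) 2(1) 3(1) by (cases l4) (auto simp: reconf_seq_def)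
  qed
  then show ?thesis
    by (simp add: numeral_eq_enat)
qed

lemma TS_graph_Mstar: "Mstar_TS TS_graph {0, 2} {0, 3} \<le> 2"
proof -
  have "matched TS_graph.d {2} {3} (TS_graph.d 2 3 + 0)"
    using matched.insert[OF matched.empty] by fastforce
  then have "matched TS_graph.d {0, 2} {0, 3} (TS_graph.d 0 0 + (TS_graph.d 2 3 + 0))"
    by (rule matched.insert) auto
  moreover have "TS_graph.d 2 3 = 2"
    by (auto simp: short_dist_def TS_graph_simps)
  ultimately have "matched TS_graph.d {0, 2} {0, 3} 2"
    by (metis TS_graph.self add.left_neutral add.right_neutral)
  then have "Mstar_TS TS_graph {0, 2} {0, 3} \<le> enat 2"
    by (rule TS_graph.Mstar_TS_le) (auto simp: TS_graph_simps)
  then show ?thesis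
    by (simp add: numeral_eq_enat)
qed

section \<open>Tight instance for jumping\<close>

text \<open>The clique vertices are the edges of a hexagon on the independent vertices, so independent
  vertices are at distance 2 exactly if they are adjacent on the hexagon.  The only dominating pairs
  of a hexagon are the antipodal ones.\<close>

definition hexagon :: "(nat \<times> nat) set" where
  "hexagon = {(0, 6), (1, 6), (1, 7), (2, 7), (2, 8), (3, 8), (3, 9), (4, 9), (4, 10), (5, 10),
     (5, 11), (0, 11)}"

definition TJ_graph :: "nat pair_pre_digraph" where
  "TJ_graph = incidence_split_graph {6, 7, 8, 9, 10, 11} {0, 1, 2, 3, 4, 5} hexagon"

interpretation TJ_graph: connected_split_graph TJ_graph "{6, 7, 8, 9, 10, 11}" "{0, 1, 2, 3, 4, 5}"
  unfolding TJ_graph_def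
  by (rule connected_split_graph_incidence) (simp_all add: hexagon_def)

lemma TJ_graph_D2DS:
  "D2DS TJ_graph {0, 3}" "D2DS TJ_graph {1, 4}"
  "\<not> D2DS TJ_graph {0, 1}" "\<not> D2DS TJ_graph {0, 4}"
  "\<not> D2DS TJ_graph {3, 1}" "\<not> D2DS TJ_graph {3, 4}"
  by (subst TJ_graph.D2DS_independent_iff;
      simp add: TJ_graph_def incidence_split_graph_def hexagon_def)+

text \<open>The two antipodal pairs are disjoint, so one jump does not suffice, and a sequence of
  two jumps would pass through a pair with one vertex of each. No such pair dominates.\<close>

lemma TJ_graph_opt: "3 \<le> opt TJ TJ_graph {0, 3} {1, 4}"
proof -
  have mid: "\<not> D2DS TJ_graph D"
    if D: "reconf_step TJ TJ_graph {0, 3} D" "reconf_step TJ TJ_graph D {1, 4}" for D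
  proof -
    obtain x y where xy: "x \<in> {0, 3}" "y \<notin> {0, 3}" "D = insert y ({0, 3} - {x})"
      using D(1) by (elim reconf_stepE)
    obtain e where e: "e \<in> {0, 3}" "e \<noteq> y" "D = {e, y}"
    proof (cases "x = 0")
      case True
      then have "{0, 3} - {x} = {3}" by auto
      then show thesis
        using that[of 3] xy by (simp add: insert_commute)
    next
      case False
      then have "{0, 3} - {x} = {0}" using xy(1) by auto
      then show thesis
        using that[of 0] xy by (simp add: insert_commute)
    qed
    obtain x' where x': "D - {1, 4} = {x'}"
      using D(2) unfolding reconf_step_def by blast
    \<comment> \<open>Only one token may still be misplaced before the last jump; the kept token
      \<open>e\<close> is, so \<open>y\<close> cannot be.\<close>
    have "y \<in> {1, 4}"
    proof (rule ccontr)
      assume "y \<notin> {1, 4}"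
      then have "{e, y} \<subseteq> D - {1, 4}"
        using e by auto
      then show False
        using e(2) unfolding x' by simp
    qed
    with e(1) have "D \<in> {{0, 1}, {0, 4}, {3, 1}, {3, 4}}"
      unfolding e(3) by auto
    then show ?thesis
      using TJ_graph_D2DS(3-6) by (elim insertE emptyE) simp_all
  qed
  have direct: "\<not> reconf_step TJ TJ_graph {0, 3} {1, 4}"
  proof -
    have "{0, 3} - {1, 4} = {0, 3 :: nat}" by auto
    then show ?thesis by (simp add: reconf_step_def doubleton_eq_iff)
  qed
  have "enat 3 \<le> opt TJ TJ_graph {0, 3} {1, 4}"
  proof (rule le_optI)
    fix l assume l: "reconf_seq TJ TJ_graph {0, 3} l {1, 4}"
    have "{0, 3} \<noteq> {1, 4 :: nat}"
      by (simp add: doubleton_eq_iff)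
    then obtain D1 l1 where 1: "l = {0, 3} # l1" "D2DS TJ_graph D1"
        "reconf_step TJ TJ_graph {0, 3} D1" "reconf_seq TJ TJ_graph D1 l1 {1, 4}"
      using reconf_seq_first_step[OF l] by metis
    have "D1 \<noteq> {1, 4}"
      using direct 1(3) by auto
    then obtain D2 l2 where 2: "l1 = D1 # l2" "reconf_step TJ TJ_graph D1 D2"
        "reconf_seq TJ TJ_graph D2 l2 {1, 4}"
      using reconf_seq_first_step[OF 1(4)] by metis
    have "D2 \<noteq> {1, 4}"
      using mid[of D1] 1(2,3) 2(2) by auto
    then obtain D3 l3 where "l2 = D2 # l3" "reconf_seq TJ TJ_graph D3 l3 {1, 4}"
      using reconf_seq_first_step[OF 2(3)] by metis
    then show "3 \<le> length l - 1"
      using 1(1) 2(1) by (cases l3) (auto simp: reconf_seq_def)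
  qed
  then show ?thesis
    by (simp add: numeral_eq_enat)
qed

theorem theorem11:
  shows "(\<forall>(G :: 'a pair_pre_digraph) K S Ds Dt k.
            split_graph G K S \<and> Digraph_Component.connected (with_proj G) \<and>
            D2DS G Ds \<and> D2DS G Dt \<and> card Ds = k \<and> card Dt = k \<longrightarrow>
              (Mstar_TS G Ds Dt \<le> opt TS G Ds Dt \<and> opt TS G Ds Dt \<le> Mstar_TS G Ds Dt + 2) \<and>
              (Mstar_TJ G Ds Dt \<le> opt TJ G Ds Dt \<and> opt TJ G Ds Dt \<le> Mstar_TJ G Ds Dt + 1))
       \<and> (\<exists>(G :: nat pair_pre_digraph) K S Ds Dt.
            split_graph G K S \<and> Digraph_Component.connected (with_proj G) \<and>
            D2DS G Ds \<and> D2DS G Dt \<and> card Ds = card Dt \<and>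
            opt TS G Ds Dt = Mstar_TS G Ds Dt + 2)
       \<and> (\<exists>(G :: nat pair_pre_digraph) K S Ds Dt.
            split_graph G K S \<and> Digraph_Component.connected (with_proj G) \<and>
            D2DS G Ds \<and> D2DS G Dt \<and> card Ds = card Dt \<and>
            opt TJ G Ds Dt = Mstar_TJ G Ds Dt + 1)"
proof (intro conjI allI impI)
  fix G :: "'a pair_pre_digraph" and K S Ds Dt k
  assume *: "split_graph G K S \<and> Digraph_Component.connected (with_proj G) \<and>
    D2DS G Ds \<and> D2DS G Dt \<and> card Ds = k \<and> card Dt = k"
  then interpret connected_split_graph G K S
    by (intro connected_split_graphI) auto
  have D: "D2DS G Ds" "D2DS G Dt" "card Ds = card Dt"
    using * by auto
  show "Mstar_TS G Ds Dt \<le> opt TS G Ds Dt"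
    using D D2DS_finite by (intro Mstar_TS_le_opt) (auto simp: D2DS_def)
  show "opt TS G Ds Dt \<le> Mstar_TS G Ds Dt + 2"
    by (rule opt_TS_le_Mstar[OF D])
  show "Mstar_TJ G Ds Dt \<le> opt TJ G Ds Dt"
    by (rule Mstar_TJ_le_opt[OF D])
  show "opt TJ G Ds Dt \<le> Mstar_TJ G Ds Dt + 1"
    by (rule opt_TJ_le_Mstar[OF D])
next
  have D: "D2DS TS_graph {0, 2}" "D2DS TS_graph {0, 3}"
    by (rule TS_graph.D2DS_if_meets_clique[of _ 0]; simp add: TS_graph_simps)+
  \<comment> \<open>The general upper bound supplies one inequality, so a lower bound on
    \<open>opt\<close> and an upper bound on \<open>Mstar_TS\<close> suffice.\<close>
  have "Mstar_TS TS_graph {0, 2} {0, 3} + 2 \<le> 2 + 2"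
    using TS_graph_Mstar by (rule add_right_mono)
  also have "(2 + 2 :: enat) \<le> opt TS TS_graph {0, 2} {0, 3}"
    using TS_graph_opt by simp
  finally have "opt TS TS_graph {0, 2} {0, 3} = Mstar_TS TS_graph {0, 2} {0, 3} + 2"
    using TS_graph.opt_TS_le_Mstar[OF D] by (intro antisym) auto
  moreover have "Digraph_Component.connected (with_proj TS_graph)"
    by (rule TS_graph.connected) (simp add: TS_graph_simps)
  ultimately show "\<exists>(G :: nat pair_pre_digraph) K S Ds Dt.
      split_graph G K S \<and> Digraph_Component.connected (with_proj G) \<and>
      D2DS G Ds \<and> D2DS G Dt \<and> card Ds = card Dt \<and> opt TS G Ds Dt = Mstar_TS G Ds Dt + 2"
    using TS_graph.split_graph D
    by (intro exI[of _ TS_graph] exI[of _ "{0, 1}"] exI[of _ "{2, 3, 4}"]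
        exI[of _ "{0, 2}"] exI[of _ "{0, 3}"]) simp
next
  note D = TJ_graph_D2DS(1,2)
  have "Mstar_TJ TJ_graph {0, 3} {1, 4} = enat (card ({0, 3} - {1, 4 :: nat}))"
    by (rule Mstar_TJ_eq) auto
  moreover have "{0, 3} - {1, 4 :: nat} = {0, 3}"
    by auto
  ultimately have M: "Mstar_TJ TJ_graph {0, 3} {1, 4} = 2"
    by (simp add: numeral_eq_enat)
  then have "opt TJ TJ_graph {0, 3} {1, 4} \<le> 3"
    using TJ_graph.opt_TJ_le_Mstar[OF D] by simp
  then have "opt TJ TJ_graph {0, 3} {1, 4} = Mstar_TJ TJ_graph {0, 3} {1, 4} + 1"
    using TJ_graph_opt M by simp
  moreover have "Digraph_Component.connected (with_proj TJ_graph)"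
    by (rule TJ_graph.connected) (simp add: TJ_graph_def incidence_split_graph_def)
  ultimately show "\<exists>(G :: nat pair_pre_digraph) K S Ds Dt.
      split_graph G K S \<and> Digraph_Component.connected (with_proj G) \<and>
      D2DS G Ds \<and> D2DS G Dt \<and> card Ds = card Dt \<and> opt TJ G Ds Dt = Mstar_TJ G Ds Dt + 1"
    using TJ_graph.split_graph D
    by (intro exI[of _ TJ_graph] exI[of _ "{6, 7, 8, 9, 10, 11}"] exI[of _ "{0, 1, 2, 3, 4, 5}"]
        exI[of _ "{0, 3}"] exI[of _ "{1, 4}"]) simp
qed

end
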